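(* Let $\mathbb D\in\{\mathbb R,\mathbb H\}$, let $A,B\in M_2(\mathbb D)$ be nonzero matrices, and let $k_1,k_2\ge 1$ be integers. Let $\omega:M_2(\mathbb D)^2\to M_2(\mathbb D)$ be the map $\omega(X,Y)=AX^{k_1}+BY^{k_2}$. Then $\omega$ is surjective if and only if one of the following conditions holds: (1) at least one of $A$ or $B$ is invertible; (2) $A$ and $B$ are both non-invertible and $\rho(A)\neq\rho(B)$, where $\rho$ denotes the row dependency ratio. Equivalently, $\operatorname{Im}(\omega)\neq M_2(\mathbb D)$ if and only if both $A$ and $B$ are non-invertible and $\rho(A)=\rho(B)$; and in this case $$\operatorname{Im}(\omega)=\{\,M\in M_2(\mathbb D)\setminus \mathrm{GL}_2(\mathbb D) : \rho(M)=\rho(A)\,\}\cup\{\theta\},$$ where $\theta$ is the zero matrix in $M_2(\mathbb D)$.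
   Context: $\mathbb H$ denotes Hamilton's real quaternion division algebra. For $\mathbb D\in\{\mathbb R,\mathbb H\}$, every nonzero non-invertible matrix $A\in M_2(\mathbb D)$ has one of the two forms $$A=\begin{pmatrix} a_1 & a_2\\ ta_1 & ta_2\end{pmatrix}\quad\text{(first form)}\qquad\text{or}\qquad A=\begin{pmatrix}0&0\\ a_1&a_2\end{pmatrix}\quad\text{(second form)},$$ where $a_1,a_2\in\mathbb D$ are not both zero and $t\in\mathbb D$ (note that $t$ multiplies on the left). The row dependency ratio of such an $A$ is the element $\rho(A)\in\mathbb D\cup\{\infty\}$ defined by $\rho(A)=t$ if $A$ has the first form and $\rho(A)=\infty$ if $A$ has the second form (zero first row). The ratio $\rho(M)$ is defined only for nonzero non-invertible $M$, so the condition $\rho(M)=\rho(A)$ implicitly requires $M$ to be nonzero. *)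

theory Defs
  imports "HOL-Analysis.Analysis"
begin

section \<open>Hamilton's quaternions\<close>

text \<open>\<open>Quat a b c d\<close> is $a + bi + cj + dk$. As for \<^typ>\<open>complex\<close>, \<open>codatatype\<close> is used
  only to have \<open>primcorec\<close> available for componentwise definitions.\<close>

codatatype quat = Quat (qRe: real) (qI: real) (qJ: real) (qK: real)

lemma quat_eq_iff: "x = y \<longleftrightarrow> qRe x = qRe y \<and> qI x = qI y \<and> qJ x = qJ y \<and> qK x = qK y"
  by (auto intro: quat.expand)

instantiation quat :: ab_group_add
begin

primcorec zero_quat where
  "qRe 0 = 0"
| "qI 0 = 0"
| "qJ 0 = 0"
| "qK 0 = 0"

primcorec plus_quat where
  "qRe (x + y) = qRe x + qRe y"
| "qI (x + y) = qI x + qI y"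
| "qJ (x + y) = qJ x + qJ y"
| "qK (x + y) = qK x + qK y"

primcorec uminus_quat where
  "qRe (- x) = - qRe x"
| "qI (- x) = - qI x"
| "qJ (- x) = - qJ x"
| "qK (- x) = - qK x"

primcorec minus_quat where
  "qRe (x - y) = qRe x - qRe y"
| "qI (x - y) = qI x - qI y"
| "qJ (x - y) = qJ x - qJ y"
| "qK (x - y) = qK x - qK y"

instance
  by standard (simp_all add: quat_eq_iff)

end

definition qnorm2 :: "quat \<Rightarrow> real" where
  "qnorm2 x = (qRe x)\<^sup>2 + (qI x)\<^sup>2 + (qJ x)\<^sup>2 + (qK x)\<^sup>2"

lemma qnorm2_eq_0_iff: "qnorm2 x = 0 \<longleftrightarrow> x = 0"
  by (simp add: qnorm2_def quat_eq_iff add_nonneg_eq_0_iff)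

instantiation quat :: division_ring
begin

primcorec one_quat where
  "qRe 1 = 1"
| "qI 1 = 0"
| "qJ 1 = 0"
| "qK 1 = 0"

primcorec times_quat where
  "qRe (x * y) = qRe x * qRe y - qI x * qI y - qJ x * qJ y - qK x * qK y"
| "qI (x * y) = qRe x * qI y + qI x * qRe y + qJ x * qK y - qK x * qJ y"
| "qJ (x * y) = qRe x * qJ y - qI x * qK y + qJ x * qRe y + qK x * qI y"
| "qK (x * y) = qRe x * qK y + qI x * qJ y - qJ x * qI y + qK x * qRe y"

primcorec inverse_quat where
  "qRe (inverse x) = qRe x / qnorm2 x"
| "qI (inverse x) = - qI x / qnorm2 x"
| "qJ (inverse x) = - qJ x / qnorm2 x"
| "qK (inverse x) = - qK x / qnorm2 x"

definition "x div y = x * inverse y" for x y :: quat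

instance
proof
  fix x y z :: quat
  show "x * y * z = x * (y * z)"
    by (simp add: quat_eq_iff algebra_simps)
  show "(x + y) * z = x * z + y * z" "x * (y + z) = x * y + x * z"
    by (simp_all add: quat_eq_iff algebra_simps)
  show "1 * x = x" "x * 1 = x" "(0::quat) \<noteq> 1"
    by (simp_all add: quat_eq_iff)
  show "inverse (0::quat) = 0"
    by (simp add: quat_eq_iff)
  show "x div y = x * inverse y"
    by (rule divide_quat_def)
  assume "x \<noteq> 0"
  then have n: "qnorm2 x \<noteq> 0"
    by (simp add: qnorm2_eq_0_iff)
  have "qRe x * qRe x + qI x * qI x + qJ x * qJ x + qK x * qK x = qnorm2 x"
    by (simp add: qnorm2_def power2_eq_square)
  with n show "inverse x * x = 1" "x * inverse x = 1"
    by (simp_all add: quat_eq_iff mult.commute flip: add_divide_distrib diff_divide_distrib)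
qed

end

lemma quat_units:
  defines "i \<equiv> Quat 0 1 0 0" and "j \<equiv> Quat 0 0 1 0" and "k \<equiv> Quat 0 0 0 1"
  shows "i * i = -1" "j * j = -1" "k * k = -1" "i * j = k" "j * k = i" "k * i = j"
  by (simp_all add: quat_eq_iff i_def j_def k_def)


section \<open>Row dependency ratio and the word map\<close>

text \<open>\<^const>\<open>times\<close> and \<^const>\<open>power\<close> on \<^typ>\<open>'a^'n^'n\<close> act entrywise, so matrix powers
  are defined through \<^const>\<open>matrix_matrix_mult\<close>.\<close>

primrec matrix_power :: "'a::semiring_1^'n^'n \<Rightarrow> nat \<Rightarrow> 'a^'n^'n" where
  "matrix_power X 0 = mat 1"
| "matrix_power X (Suc k) = X ** matrix_power X k"

definition mat22 :: "'a::zero \<Rightarrow> 'a \<Rightarrow> 'a \<Rightarrow> 'a \<Rightarrow> 'a^2^2" where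
  "mat22 a b c d = vector [vector [a, b], vector [c, d]]"

definition first_form :: "'a::division_ring \<Rightarrow> 'a^2^2 \<Rightarrow> bool" where
  "first_form t A \<longleftrightarrow> (\<exists>a1 a2. \<not> (a1 = 0 \<and> a2 = 0) \<and> A = mat22 a1 a2 (t * a1) (t * a2))"

definition second_form :: "'a::division_ring^2^2 \<Rightarrow> bool" where
  "second_form A \<longleftrightarrow> (\<exists>a1 a2. \<not> (a1 = 0 \<and> a2 = 0) \<and> A = mat22 0 0 a1 a2)"

text \<open>The ratio takes values in $\mathbb D \cup \{\infty\}$.\<close>

datatype 'a ratio = Finite 'a | Infty

text \<open>Only meaningful for nonzero non-invertible matrices; unspecified otherwise.\<close>

definition row_ratio :: "'a::division_ring^2^2 \<Rightarrow> 'a ratio" where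
  "row_ratio A = (if second_form A then Infty else Finite (THE t. first_form t A))"

definition word_map ::
    "'a::division_ring^2^2 \<Rightarrow> 'a^2^2 \<Rightarrow> nat \<Rightarrow> nat \<Rightarrow> ('a^2^2) \<times> ('a^2^2) \<Rightarrow> 'a^2^2" where
  "word_map A B k1 k2 = (\<lambda>(X, Y). A ** matrix_power X k1 + B ** matrix_power Y k2)"


subsection \<open>Well-definedness of the ratio\<close>

lemma mat22_nth [simp]:
  "mat22 a b c d $ 1 $ 1 = a" "mat22 a b c d $ 1 $ 2 = b"
  "mat22 a b c d $ 2 $ 1 = c" "mat22 a b c d $ 2 $ 2 = d"
  by (simp_all add: mat22_def)

lemma mat22_eq_iff [simp]:
  "mat22 a b c d = mat22 a' b' c' d' \<longleftrightarrow> a = a' \<and> b = b' \<and> c = c' \<and> d = d'"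
  by (metis mat22_nth)

lemma mat22_cases: obtains a b c d where "A = mat22 a b c d"
proof
  show "A = mat22 (A$1$1) (A$1$2) (A$2$1) (A$2$2)"
    by (simp add: vec_eq_iff forall_2)
qed

lemma row_ratio_first_form:
  assumes "first_form t A"
  shows "row_ratio A = Finite t"
proof -
  have "\<not> second_form A"
    using assms by (auto simp: first_form_def second_form_def)
  moreover have "(THE t. first_form t A) = t"
    using assms by (auto simp: first_form_def)
  ultimately show ?thesis
    by (simp add: row_ratio_def)
qed

lemma row_ratio_second_form: "second_form A \<Longrightarrow> row_ratio A = Infty"
  by (simp add: row_ratio_def)

lemma mat22_mult:
  "mat22 a b c d ** mat22 a' b' c' d' =
    mat22 (a * a' + b * c') (a * b' + b * d') (c * a' + d * c') (c * b' + d * d')"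
  for a :: "'a::semiring_1"
  by (simp add: vec_eq_iff forall_2 matrix_matrix_mult_def sum_2)

lemma mat_1_mat22: "mat 1 = (mat22 1 0 0 1 :: 'a::semiring_1^2^2)"
  by (simp add: vec_eq_iff forall_2 mat_def)

lemma zero_mat22: "0 = mat22 0 0 0 0"
  by (simp add: vec_eq_iff forall_2)

lemma singular_forms:
  fixes A :: "'a::division_ring^2^2"
  assumes "A \<noteq> 0" "\<not> invertible A"
  shows "(\<exists>t. first_form t A) \<or> second_form A"
proof -
  obtain a b c d where A: "A = mat22 a b c d"
    by (rule mat22_cases)
  consider "a = 0" "b = 0" | "a \<noteq> 0" | "a = 0" "b \<noteq> 0"
    by blast
  then show ?thesis
  proof cases
    case 1
    with assms A have "second_form A"
      by (auto simp: second_form_def zero_mat22)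
    then show ?thesis ..
  next
    case 2
    define s where "s = d - c * inverse a * b"
    define p where "p = c * inverse a"
    define q where "q = inverse a * b"
    have c: "c = p * a" and b: "b = a * q"
      using 2 by (simp_all add: p_def q_def mult.assoc flip: mult.assoc [of a])
    have d: "d = p * a * q + s"
      by (simp add: s_def p_def q_def mult.assoc) (simp add: 2 flip: mult.assoc [of a])
    have "s = 0"
    proof (rule ccontr)
      assume s: "s \<noteq> 0"
      let ?B = "mat22 (inverse a + q * inverse s * p) (- (q * inverse s)) (- (inverse s * p)) (inverse s)"
      have [simp]: "a * (inverse a * x) = x" "inverse a * (a * x) = x"
        "s * (inverse s * x) = x" "inverse s * (s * x) = x" for x
        using 2 s by (simp_all flip: mult.assoc)
      have "A ** ?B = mat 1" "?B ** A = mat 1"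
        using 2 s by (simp_all add: A mat22_mult mat_1_mat22 b c d algebra_simps)
      with assms show False
        by (auto simp: invertible_def)
    qed
    with 2 have "first_form p A"
      by (auto simp: first_form_def A b c d mult.assoc)
    then show ?thesis by blast
  next
    case 3
    have "c = 0"
    proof (rule ccontr)
      assume c: "c \<noteq> 0"
      let ?B = "mat22 (- (inverse c * d * inverse b)) (inverse c) (inverse b) 0"
      have [simp]: "c * (inverse c * x) = x" for x
        using c by (simp flip: mult.assoc)
      have "A ** ?B = mat 1" "?B ** A = mat 1"
        using 3 c by (simp_all add: A mat22_mult mat_1_mat22 mult.assoc)
      with assms show False
        by (auto simp: invertible_def)
    qed
    with 3 have "first_form (d * inverse b) A"
      by (auto simp: first_form_def A mult.assoc)
    then show ?thesis by blast
  qed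
qed

end

theory Submission
  imports Defs
begin

text \<open>
  A nonzero singular matrix of row ratio $\rho$ is $C_\rho Q$ with $Q$ invertible, where $C_\rho$ has
  zero second column and its first column is $(1, t)^T$ or $(0, 1)^T$. Left multiplication by $C_\rho$
  sees only the top row of its argument, and the matrices $C_\rho R$ are exactly zero and the singular
  matrices of ratio $\rho$ (\<open>range_slope_matrix_mult\<close>). The proof rests on two properties of
  the set of $k$-th powers, $k \ge 1$:

  \<^item> (rows) every row vector is the top row of some $k$-th power;
  \<^item> (sums) for invertible $N$, every matrix has the form $X^{k_1} + N Y^{k_2}$.

  By (rows) and conjugation with $Q$, the matrices $A X^k$ for singular $A$ are all the matrices
  $C_{\rho(A)} R$ (\<open>singular_times_powers\<close>). Hence for singular $A$ and $B$ of equal ratio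
  the image consists of the matrices $C_\rho R$, while for distinct ratios the two leading columns
  form a basis and the map is onto. If only $B$ is singular, a conjugation moves its column space to
  the second coordinate axis. The summand with $Y$ then supplies an arbitrary bottom row, and (rows)
  supplies the top row. If both are invertible, (sums) applies to $N = A^{-1} B$. This part is
  \<open>word_map_image_of_power_rows\<close> and holds over every division ring with (rows) and (sums).

  Over the quaternions every scalar has $k$-th roots, so a rank-one matrix $u v$ (column times row)
  has a $k$-th root as soon as the scalar $v u$ is nonzero. This gives (rows). For (sums), let
  $M \neq 0$ and let $X^{k_1}$ be a matrix of rank at most one with the top row of $M$. Then
  $N^{-1}(M - X^{k_1})$ has rank at most one, and, up to an exchange of the coordinates, the bottom
  row of $X^{k_1}$ leaves enough freedom to make its scalar nonzero
  (\<open>power_sum_column\<close>).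

  Over the reals negative scalars may have no roots, but $u I + v J$ with $J^2 = -I$ lies in a copy of
  the complex numbers. So scalar matrices, and matrices whose characteristic polynomial has negative
  discriminant, have all roots. This gives (rows), and (sums) is proved by choosing $Z$ such that $Z$
  and $M - N Z$ are both of this kind. If $N$ has no real eigenvalue or $\det N > 0$, one can
  let entries of $Z$ tend to infinity. If $\det N < 0$, then $N$ can be taken diagonal. A
  nonzero off-diagonal entry of $M$ still admits such a $Z$ with one large entry, and a diagonal $M$
  is reached with $Z$ and $M - N Z$ both scalar.
\<close>

section \<open>Powers and conjugation of 2x2 matrices over a division ring\<close>

lemma mat22_add: "mat22 a b c d + mat22 a' b' c' d' = mat22 (a + a') (b + b') (c + c') (d + d')"
  for a :: "'a::monoid_add"
  by (simp add: vec_eq_iff forall_2)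

lemma matrix_add_rdistrib: "(A + B) ** C = A ** C + B ** C"
  for A B :: "'a::semiring_1^'n^'m"
  by (simp add: matrix_matrix_mult_def vec_eq_iff distrib_right sum.distrib)

lemma invertible_obtains_inverse:
  assumes "invertible A"
  obtains A' where "A ** A' = mat 1" "A' ** A = mat 1"
  using assms unfolding invertible_def by blast

lemma matrix_power_conjugate:
  fixes P P' X :: "'a::semiring_1^'n^'n"
  assumes "P ** P' = mat 1" "P' ** P = mat 1"
  shows "matrix_power (P ** X ** P') k = P ** matrix_power X k ** P'"
proof (induction k)
  case 0
  then show ?case using assms by simp
next
  case (Suc k)
  have "matrix_power (P ** X ** P') (Suc k) = P ** X ** (P' ** P) ** matrix_power X k ** P'"
    by (simp add: Suc matrix_mul_assoc)
  then show ?case using assms by (simp add: matrix_mul_assoc)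
qed

text \<open>The problem of writing $M$ as $X^{k_1} + N Y^{k_2}$ is invariant under simultaneous
  conjugation, which allows normal forms for $N$.\<close>

lemma power_sum_conjugate:
  fixes P P' M N :: "'a::semiring_1^'n^'n"
  assumes P: "P ** P' = mat 1" "P' ** P = mat 1"
    and ex: "\<exists>X Y. matrix_power X k1 + (P' ** N ** P) ** matrix_power Y k2 = P' ** M ** P"
  shows "\<exists>X Y. matrix_power X k1 + N ** matrix_power Y k2 = M"
proof -
  obtain X Y where XY: "matrix_power X k1 + (P' ** N ** P) ** matrix_power Y k2 = P' ** M ** P"
    using ex by blast
  have "matrix_power (P ** X ** P') k1 + N ** matrix_power (P ** Y ** P') k2
      = P ** matrix_power X k1 ** P' + N ** P ** matrix_power Y k2 ** P'"
    by (simp add: matrix_power_conjugate[OF P] matrix_mul_assoc)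
  also have "\<dots> = P ** matrix_power X k1 ** P' + (P ** P') ** N ** P ** matrix_power Y k2 ** P'"
    by (simp add: P)
  also have "\<dots> = P ** (matrix_power X k1 + (P' ** N ** P) ** matrix_power Y k2) ** P'"
    by (simp add: matrix_add_ldistrib matrix_add_rdistrib matrix_mul_assoc)
  also have "\<dots> = (P ** P') ** M ** (P ** P')"
    unfolding XY by (simp add: matrix_mul_assoc)
  finally show ?thesis using P by auto
qed

section \<open>Singular matrices and their row ratio\<close>

text \<open>The column that determines the ratio, padded with a zero column so that products of
  square matrices suffice.\<close>

definition slope_matrix :: "'a::division_ring ratio \<Rightarrow> 'a^2^2" where
  "slope_matrix \<rho> = (case \<rho> of Finite t \<Rightarrow> mat22 1 0 t 0 | Infty \<Rightarrow> mat22 0 0 1 0)"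

lemma slope_matrix_mult:
  "slope_matrix (Finite t) ** mat22 a b c d = mat22 a b (t * a) (t * b)"
  "slope_matrix Infty ** mat22 a b c d = mat22 0 0 a b"
  by (simp_all add: slope_matrix_def mat22_mult)

lemma slope_matrix_top_row: "slope_matrix \<rho> ** mat22 1 0 0 0 = slope_matrix \<rho>"
  by (cases \<rho>) (simp_all add: slope_matrix_mult, simp_all add: slope_matrix_def)

lemma nonzero_row_completes:
  fixes a b :: "'a::division_ring"
  assumes "\<not> (a = 0 \<and> b = 0)"
  shows "\<exists>c d. invertible (mat22 a b c d)"
proof (cases "a = 0")
  case True
  with assms have "mat22 a b 1 0 ** mat22 0 1 (inverse b) 0 = mat 1"
    "mat22 0 1 (inverse b) 0 ** mat22 a b 1 0 = mat 1"
    by (auto simp: mat22_mult mat_1_mat22)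
  then show ?thesis unfolding invertible_def by blast
next
  case False
  then have "mat22 a b 0 1 ** mat22 (inverse a) (- (inverse a * b)) 0 1 = mat 1"
    "mat22 (inverse a) (- (inverse a * b)) 0 1 ** mat22 a b 0 1 = mat 1"
    by (auto simp: mat22_mult mat_1_mat22 simp flip: mult.assoc)
  then show ?thesis unfolding invertible_def by blast
qed

text \<open>The nonzero row $(a_1, a_2)$ of the normal form is only relevant up to an invertible
  factor, because it can be completed to an invertible matrix.\<close>

lemma singular_factorization:
  fixes A :: "'a::division_ring^2^2"
  assumes "A \<noteq> 0" "\<not> invertible A"
  shows "\<exists>Q. invertible Q \<and> A = slope_matrix (row_ratio A) ** Q"
  using singular_forms[OF assms]
proof (elim disjE exE)
  fix t assume t: "first_form t A"
  then obtain a b where ab: "\<not> (a = 0 \<and> b = 0)" "A = mat22 a b (t * a) (t * b)"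
    unfolding first_form_def by blast
  with nonzero_row_completes[OF ab(1)] row_ratio_first_form[OF t] show ?thesis
    by (metis slope_matrix_mult(1))
next
  assume t: "second_form A"
  then obtain a b where ab: "\<not> (a = 0 \<and> b = 0)" "A = mat22 0 0 a b"
    unfolding second_form_def by blast
  with nonzero_row_completes[OF ab(1)] row_ratio_second_form[OF t] show ?thesis
    by (metis slope_matrix_mult(2))
qed

text \<open>A change of basis moves the column of the slope matrix to the second coordinate axis.\<close>

lemma slope_matrix_column:
  "\<exists>S. invertible S \<and> slope_matrix \<rho> = S ** mat22 0 0 1 0"
proof (cases \<rho>)
  case (Finite t)
  have "mat22 0 1 1 t ** mat22 (- t) 1 1 0 = mat 1" "mat22 (- t) 1 1 0 ** mat22 0 1 1 t = mat 1"
    by (simp_all add: mat22_mult mat_1_mat22)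
  then have "invertible (mat22 0 1 1 t)"
    unfolding invertible_def by blast
  then show ?thesis
    by (intro exI[of _ "mat22 0 1 1 t"]) (simp add: Finite slope_matrix_def mat22_mult)
next
  case Infty
  have "invertible (mat 1 :: 'a^2^2)"
    unfolding invertible_def by (intro exI[of _ "mat 1"]) simp
  then show ?thesis
    by (intro exI[of _ "mat 1"]) (simp add: Infty slope_matrix_def)
qed

text \<open>The row $(-t, 1)$, or $(1, 0)$ for infinite ratio, annihilates the slope matrix from the left.\<close>

lemma slope_matrix_mult_not_invertible:
  fixes R :: "'a::division_ring^2^2"
  shows "\<not> invertible (slope_matrix \<rho> ** R)"
proof
  assume "invertible (slope_matrix \<rho> ** R)"
  then obtain R' where R': "slope_matrix \<rho> ** R ** R' = mat 1"
    by (rule invertible_obtains_inverse)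
  define K :: "'a^2^2" where "K = (case \<rho> of Finite t \<Rightarrow> mat22 0 0 (- t) 1 | Infty \<Rightarrow> mat22 1 0 0 0)"
  have "K ** slope_matrix \<rho> = 0" "K \<noteq> 0"
    by (cases \<rho>; simp add: K_def slope_matrix_def mat22_mult zero_mat22)+
  moreover have "K = K ** slope_matrix \<rho> ** (R ** R')"
    using R' by (metis matrix_mul_assoc matrix_mul_rid)
  moreover have "0 ** (R ** R') = (0 :: 'a^2^2)"
    by (simp add: matrix_matrix_mult_def vec_eq_iff)
  ultimately show False by simp
qed

lemma range_slope_matrix_mult:
  fixes \<rho> :: "'a::division_ring ratio"
  shows "range (\<lambda>R :: 'a^2^2. slope_matrix \<rho> ** R) = {M. \<not> invertible M \<and> M \<noteq> 0 \<and> row_ratio M = \<rho>} \<union> {0}"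
proof (intro equalityI subsetI)
  fix M :: "'a^2^2"
  assume "M \<in> range (\<lambda>R :: 'a^2^2. slope_matrix \<rho> ** R)"
  then obtain a b c d where M: "M = slope_matrix \<rho> ** mat22 a b c d"
    by (elim imageE) (metis mat22_cases)
  have "row_ratio M = \<rho>" if "M \<noteq> 0"
  proof (cases \<rho>)
    case (Finite t)
    with that M have "first_form t M"
      unfolding first_form_def by (auto simp: slope_matrix_mult zero_mat22)
    then show ?thesis by (simp add: row_ratio_first_form Finite)
  next
    case Infty
    with that M have "second_form M"
      unfolding second_form_def by (auto simp: slope_matrix_mult zero_mat22)
    then show ?thesis by (simp add: row_ratio_second_form Infty)
  qed
  then show "M \<in> {M. \<not> invertible M \<and> M \<noteq> 0 \<and> row_ratio M = \<rho>} \<union> {0}"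
    using slope_matrix_mult_not_invertible[of \<rho>, where R="mat22 a b c d"] M by auto
next
  fix M :: "'a^2^2"
  assume "M \<in> {M. \<not> invertible M \<and> M \<noteq> 0 \<and> row_ratio M = \<rho>} \<union> {0}"
  moreover have "0 = slope_matrix \<rho> ** (0 :: 'a^2^2)"
    by (simp add: matrix_matrix_mult_def vec_eq_iff)
  ultimately show "M \<in> range (\<lambda>R :: 'a^2^2. slope_matrix \<rho> ** R)"
    using singular_factorization[of M] by blast
qed

text \<open>The leading columns of two different slope matrices form a basis of the column space.\<close>

lemma distinct_slopes_span:
  fixes M :: "'a::division_ring^2^2"
  assumes "\<rho> \<noteq> \<sigma>"
  shows "\<exists>R S. slope_matrix \<rho> ** R + slope_matrix \<sigma> ** S = M"
proof -
  have finite_infinite: "\<exists>R S. slope_matrix (Finite t) ** R + slope_matrix Infty ** S = M" for t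
  proof -
    obtain a b c d where "M = mat22 a b c d" by (rule mat22_cases)
    then have "slope_matrix (Finite t) ** mat22 a b 0 0
        + slope_matrix Infty ** mat22 (c - t * a) (d - t * b) 0 0 = M"
      by (simp add: slope_matrix_mult mat22_add)
    then show ?thesis by blast
  qed
  show ?thesis
  proof (cases \<rho>; cases \<sigma>)
    fix t s assume ts: "\<rho> = Finite t" "\<sigma> = Finite s"
    obtain a b c d where M: "M = mat22 a b c d" by (rule mat22_cases)
    define r where "r = inverse (s - t)"
    have r: "s * (r * x) = x + t * (r * x)" for x
    proof -
      have "(s - t) * (r * x) = x"
        using ts assms by (simp add: r_def flip: mult.assoc)
      then show ?thesis by (simp add: algebra_simps)
    qed
    let ?x = "r * (c - t * a)" and ?y = "r * (d - t * b)"
    have "slope_matrix \<rho> ** mat22 (a - ?x) (b - ?y) 0 0 + slope_matrix \<sigma> ** mat22 ?x ?y 0 0 = M"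
      unfolding ts slope_matrix_mult mat22_add M r by (simp add: algebra_simps)
    then show ?thesis by blast
  next
    fix t assume "\<rho> = Finite t" "\<sigma> = Infty"
    then show ?thesis using finite_infinite by blast
  next
    fix t assume "\<rho> = Infty" "\<sigma> = Finite t"
    then show ?thesis using finite_infinite by (metis add.commute)
  next
    assume "\<rho> = Infty" "\<sigma> = Infty"
    then show ?thesis using assms by simp
  qed
qed

section \<open>The image of the word map, given enough powers\<close>

text \<open>With $A = C_\rho Q$, conjugation gives $A (Q^{-1} Y Q)^k = C_\rho Y^k Q$, and $C_\rho Y^k$
  depends only on the top row of $Y^k$, which is arbitrary.\<close>

lemma singular_times_powers:
  fixes A :: "'a::division_ring^2^2"
  assumes rows: "\<And>p q :: 'a. \<exists>Y c d. matrix_power Y k = mat22 p q c d"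
    and A: "A \<noteq> 0" "\<not> invertible A"
  shows "range (\<lambda>X. A ** matrix_power X k) = range (\<lambda>R :: 'a^2^2. slope_matrix (row_ratio A) ** R)"
proof -
  define \<rho> where "\<rho> = row_ratio A"
  let ?C = "slope_matrix \<rho>"
  obtain Q where "invertible Q" and AQ: "A = ?C ** Q"
    using singular_factorization[OF A] unfolding \<rho>_def by blast
  then obtain Q' where Q: "Q ** Q' = mat 1" "Q' ** Q = mat 1"
    by (metis invertible_obtains_inverse)
  have "\<exists>X. A ** matrix_power X k = ?C ** R" for R
  proof -
    obtain p q r s where pq: "R ** Q' = mat22 p q r s" by (rule mat22_cases)
    obtain Y c d where Y: "matrix_power Y k = mat22 p q c d"
      using rows by blast
    have "A ** matrix_power (Q' ** Y ** Q) k = ?C ** (Q ** Q') ** matrix_power Y k ** Q"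
      by (simp add: AQ matrix_power_conjugate[OF Q(2,1)] matrix_mul_assoc)
    also have "\<dots> = ?C ** mat22 p q c d ** Q"
      using Q Y by simp
    also have "?C ** mat22 p q c d = ?C ** mat22 p q r s"
      by (cases \<rho>) (simp_all add: slope_matrix_mult)
    also have "?C ** mat22 p q r s ** Q = ?C ** R ** (Q' ** Q)"
      by (simp add: matrix_mul_assoc flip: pq)
    also have "\<dots> = ?C ** R"
      using Q by simp
    finally show ?thesis by blast
  qed
  moreover have "A ** matrix_power X k = ?C ** (Q ** matrix_power X k)" for X
    using AQ by (metis matrix_mul_assoc)
  ultimately show ?thesis
    unfolding \<rho>_def[symmetric] by (intro equalityI subsetI; elim imageE) (metis rangeI)+
qed

text \<open>After multiplication by $A^{-1}$ and a conjugation, the products with the singular matrix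
  $B$ are exactly the matrices with zero top row. So it is enough that some $k_1$-th power has the
  prescribed top row.\<close>

lemma invertible_and_singular_surjective:
  fixes A B :: "'a::division_ring^2^2"
  assumes rows1: "\<And>p q :: 'a. \<exists>Y c d. matrix_power Y k1 = mat22 p q c d"
    and rows2: "\<And>p q :: 'a. \<exists>Y c d. matrix_power Y k2 = mat22 p q c d"
    and A: "invertible A" and B: "B \<noteq> 0" "\<not> invertible B"
  shows "\<exists>X Y. A ** matrix_power X k1 + B ** matrix_power Y k2 = M"
proof -
  obtain A' where A': "A ** A' = mat 1" "A' ** A = mat 1"
    using A by (rule invertible_obtains_inverse)
  obtain S where "invertible S" and S: "slope_matrix (row_ratio B) = S ** mat22 0 0 1 0"
    using slope_matrix_column by blast
  then obtain S' where S': "S ** S' = mat 1" "S' ** S = mat 1"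
    by (metis invertible_obtains_inverse)
  \<comment> \<open>The second column of $A^{-1} S$ spans the column space of $A^{-1} B$.\<close>
  define P P' where "P = A' ** S" and "P' = S' ** A"
  have "P ** P' = A' ** (S ** S') ** A" "P' ** P = S' ** (A ** A') ** S"
    by (simp_all add: P_def P'_def matrix_mul_assoc)
  then have P: "P ** P' = mat 1" "P' ** P = mat 1"
    using A' S' by simp_all
  obtain p q r s where T: "S' ** M ** P = mat22 p q r s"
    by (rule mat22_cases)
  obtain X c d where X: "matrix_power X k1 = mat22 p q c d"
    using rows1 by blast
  have "slope_matrix (row_ratio B) ** (mat22 (r - c) (s - d) 0 0 ** P')
      \<in> range (\<lambda>Y. B ** matrix_power Y k2)"
    unfolding singular_times_powers[OF rows2 B] by blast
  then obtain Y where Y: "slope_matrix (row_ratio B) ** (mat22 (r - c) (s - d) 0 0 ** P') = B ** matrix_power Y k2"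
    by (rule imageE)
  have "A ** matrix_power (P ** X ** P') k1 = (A ** A') ** S ** matrix_power X k1 ** P'"
    by (simp add: matrix_power_conjugate[OF P]) (simp add: P_def matrix_mul_assoc)
  then have "A ** matrix_power (P ** X ** P') k1 + B ** matrix_power Y k2
      = S ** (mat22 p q c d + mat22 0 0 1 0 ** mat22 (r - c) (s - d) 0 0) ** P'"
    using A' by (simp add: S X matrix_add_ldistrib matrix_add_rdistrib matrix_mul_assoc flip: Y)
  also have "mat22 p q c d + mat22 0 0 1 0 ** mat22 (r - c) (s - d) 0 0 = mat22 p q r s"
    by (simp add: mat22_mult mat22_add)
  also have "S ** mat22 p q r s ** P' = (S ** S') ** M ** (P ** P')"
    by (simp add: matrix_mul_assoc flip: T)
  finally show ?thesis
    using P S' by auto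
qed

text \<open>This separates the linear algebra, which is the same over every division ring, from the
  supply of matrix powers, which depends on the ring.\<close>

theorem word_map_image_of_power_rows:
  fixes A B :: "'a::division_ring^2^2"
  assumes rows1: "\<And>p q :: 'a. \<exists>Y c d. matrix_power Y k1 = mat22 p q c d"
    and rows2: "\<And>p q :: 'a. \<exists>Y c d. matrix_power Y k2 = mat22 p q c d"
    and inv: "\<And>N M :: 'a^2^2. invertible N \<Longrightarrow> \<exists>X Y. matrix_power X k1 + N ** matrix_power Y k2 = M"
    and nz: "A \<noteq> 0" "B \<noteq> 0"
  shows "(surj (word_map A B k1 k2) \<longleftrightarrow>
         (invertible A \<or> invertible B) \<or>
         (\<not> invertible A \<and> \<not> invertible B \<and> row_ratio A \<noteq> row_ratio B)) \<and>
      (range (word_map A B k1 k2) \<noteq> UNIV \<longleftrightarrow>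
         \<not> invertible A \<and> \<not> invertible B \<and> row_ratio A = row_ratio B) \<and>
      (\<not> invertible A \<and> \<not> invertible B \<and> row_ratio A = row_ratio B \<longrightarrow>
         range (word_map A B k1 k2) =
           {M. \<not> invertible M \<and> M \<noteq> 0 \<and> row_ratio M = row_ratio A} \<union> {0})"
proof -
  let ?w = "\<lambda>X Y. A ** matrix_power X k1 + B ** matrix_power Y k2"
  have w: "range (word_map A B k1 k2) = {M. \<exists>X Y. ?w X Y = M}"
    by (force simp: word_map_def image_iff)
  have onto: "\<exists>X Y. ?w X Y = M" if cond: "invertible A \<or> invertible B \<or> row_ratio A \<noteq> row_ratio B" for M
  proof -
    consider "invertible A" "invertible B" | "invertible A" "\<not> invertible B"
      | "\<not> invertible A" "invertible B"
      | "\<not> invertible A" "\<not> invertible B" "row_ratio A \<noteq> row_ratio B"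
      using cond by blast
    then show ?thesis
    proof cases
      case 1
      then obtain A' where A': "A ** A' = mat 1" "A' ** A = mat 1"
        by (metis invertible_obtains_inverse)
      then have "invertible A'"
        unfolding invertible_def by blast
      then have "invertible (A' ** B)"
        using 1 invertible_mult by blast
      then obtain X Y where "matrix_power X k1 + (A' ** B) ** matrix_power Y k2 = A' ** M"
        using inv by blast
      then have "A ** (matrix_power X k1 + (A' ** B) ** matrix_power Y k2) = A ** (A' ** M)"
        by simp
      then have "?w X Y = M"
        using A' by (simp add: matrix_add_ldistrib matrix_mul_assoc)
      then show ?thesis by blast
    next
      case 2
      then show ?thesis using invertible_and_singular_surjective[OF rows1 rows2] nz by blast
    next
      case 3
      then show ?thesis
        using invertible_and_singular_surjective[OF rows2 rows1, of B A M] nz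
        by (metis add.commute)
    next
      case 4
      then obtain R S where "slope_matrix (row_ratio A) ** R + slope_matrix (row_ratio B) ** S = M"
        using distinct_slopes_span by blast
      moreover have "slope_matrix (row_ratio A) ** R \<in> range (\<lambda>X. A ** matrix_power X k1)"
        using singular_times_powers[OF rows1] nz 4 by simp
      then obtain X where "slope_matrix (row_ratio A) ** R = A ** matrix_power X k1"
        by (rule imageE)
      moreover have "slope_matrix (row_ratio B) ** S \<in> range (\<lambda>Y. B ** matrix_power Y k2)"
        using singular_times_powers[OF rows2] nz 4 by simp
      then obtain Y where "slope_matrix (row_ratio B) ** S = B ** matrix_power Y k2"
        by (rule imageE)
      ultimately show ?thesis by metis
    qed
  qed
  have small: "range (word_map A B k1 k2) = range (\<lambda>R :: 'a^2^2. slope_matrix (row_ratio A) ** R)"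
    if sing: "\<not> invertible A" "\<not> invertible B" "row_ratio A = row_ratio B"
  proof -
    let ?C = "slope_matrix (row_ratio A)"
    have imA: "range (\<lambda>X. A ** matrix_power X k1) = range (\<lambda>R :: 'a^2^2. ?C ** R)"
      and imB: "range (\<lambda>X. B ** matrix_power X k2) = range (\<lambda>R :: 'a^2^2. ?C ** R)"
      using singular_times_powers[OF rows1] singular_times_powers[OF rows2] nz sing by auto
    show ?thesis
    proof (intro equalityI subsetI)
      fix M assume "M \<in> range (word_map A B k1 k2)"
      then obtain X Y where "?w X Y = M" unfolding w by blast
      moreover obtain R where "A ** matrix_power X k1 = ?C ** R"
        using imA by blast
      moreover obtain S where "B ** matrix_power Y k2 = ?C ** S"
        using imB by blast
      ultimately have "M = ?C ** (R + S)"
        by (simp add: matrix_add_ldistrib)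
      then show "M \<in> range (\<lambda>R :: 'a^2^2. ?C ** R)" by blast
    next
      fix M assume "M \<in> range (\<lambda>R :: 'a^2^2. ?C ** R)"
      then obtain X where X: "M = A ** matrix_power X k1"
        unfolding imA[symmetric] by (rule imageE)
      have "0 \<in> range (\<lambda>R :: 'a^2^2. ?C ** R)"
        unfolding range_slope_matrix_mult by blast
      then obtain Y where "0 = B ** matrix_power Y k2"
        unfolding imB[symmetric] by (rule imageE)
      with X have "?w X Y = M" by simp
      then show "M \<in> range (word_map A B k1 k2)" unfolding w by blast
    qed
  qed
  have "mat 1 \<notin> range (\<lambda>R :: 'a^2^2. slope_matrix (row_ratio A) ** R)"
  proof
    assume "mat 1 \<in> range (\<lambda>R :: 'a^2^2. slope_matrix (row_ratio A) ** R)"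
    then have "\<not> invertible (mat 1 :: 'a^2^2)"
      unfolding range_slope_matrix_mult by (auto simp: zero_mat22 mat_1_mat22)
    then show False
      by (auto simp: invertible_def intro: exI[of _ "mat 1"])
  qed
  then have notonto: "range (word_map A B k1 k2) \<noteq> UNIV"
    if "\<not> invertible A" "\<not> invertible B" "row_ratio A = row_ratio B"
    using small[OF that] by blast
  have univ: "range (word_map A B k1 k2) = UNIV"
    if "invertible A \<or> invertible B \<or> row_ratio A \<noteq> row_ratio B"
    using onto[OF that] unfolding w by blast
  show ?thesis
  proof (cases "\<not> invertible A \<and> \<not> invertible B \<and> row_ratio A = row_ratio B")
    case True
    with small notonto show ?thesis by (simp add: range_slope_matrix_mult)
  next
    case False
    with univ have "range (word_map A B k1 k2) = UNIV" by argo
    with False show ?thesis by argo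
  qed
qed

section \<open>Roots of rank-one matrices\<close>

text \<open>Inside a power of $u v$ the inner factors $v u = z$ are scalars: $(u v)^{j+1} = u z^j v$.\<close>

lemma matrix_power_outer_product:
  fixes a b x y :: "'a::division_ring"
  assumes "a * x + b * y = z"
  shows "matrix_power (mat22 (x * a) (x * b) (y * a) (y * b)) (Suc j) =
    mat22 (x * (z ^ j * a)) (x * (z ^ j * b)) (y * (z ^ j * a)) (y * (z ^ j * b))"
proof (induction j)
  case 0
  then show ?case by simp
next
  case (Suc j)
  have "u * a * (x * (z ^ j * v)) + u * b * (y * (z ^ j * v)) = u * (z ^ Suc j * v)" for u v
    by (simp add: mult.assoc distrib_left distrib_right flip: assms)
  with Suc show ?case by (simp add: mat22_mult)
qed

text \<open>If $c = v u \neq 0$ and $z^k = c$, then $u (z c^{-1} v)$ is a $k$-th root of $u v$, because the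
  scalar of this product is $z$.\<close>

lemma outer_product_root:
  fixes a b x y :: "'a::division_ring"
  assumes k: "k \<ge> 1" and z: "z ^ k = a * x + b * y" and nz: "a * x + b * y \<noteq> 0"
  shows "\<exists>Y. matrix_power Y k = mat22 (x * a) (x * b) (y * a) (y * b)"
proof -
  obtain j where j: "k = Suc j" using k by (cases k) auto
  define e where "e = inverse (a * x + b * y)"
  have "(z * e * a) * x + (z * e * b) * y = z * (e * (a * x + b * y))"
    by (simp add: mult.assoc distrib_left)
  then have "(z * e * a) * x + (z * e * b) * y = z"
    using nz by (simp add: e_def)
  note pow = matrix_power_outer_product[OF this, of j]
  have "z ^ j * (z * e * v) = v" for v
  proof -
    have "z ^ j * (z * e * v) = (z ^ j * z) * e * v"
      by (simp add: mult.assoc)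
    also have "z ^ j * z = a * x + b * y"
      using z by (simp add: j power_Suc2 del: power_Suc)
    finally show ?thesis using nz by (simp add: e_def)
  qed
  with pow show ?thesis unfolding j by (intro exI) simp
qed

text \<open>The instance $u = (1, s)^T$, $v = (p, q)$.\<close>

lemma power_with_top_row:
  fixes p q s :: "'a::division_ring"
  assumes "k \<ge> 1" "z ^ k = p + q * s" "p + q * s \<noteq> 0"
  shows "\<exists>Y. matrix_power Y k = mat22 p q (s * p) (s * q)"
  using outer_product_root[of k z p 1 q s] assms by simp

lemma matrix_power_zero: "k \<ge> 1 \<Longrightarrow> matrix_power (0 :: 'a::semiring_1^'n^'n) k = 0"
  by (cases k) (simp_all add: matrix_matrix_mult_def vec_eq_iff)

section \<open>Division rings in which every element has roots\<close>

lemma power_rows_of_roots: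
  fixes p q :: "'a::division_ring"
  assumes k: "k \<ge> 1" and roots: "\<And>c :: 'a. \<exists>z. z ^ k = c"
  shows "\<exists>Y c d. matrix_power Y k = mat22 p q c d"
proof (cases "p = 0 \<and> q = 0")
  case True
  with matrix_power_zero[OF k, where 'a='a and 'n=2] show ?thesis
    by (metis zero_mat22)
next
  case False
  \<comment> \<open>With this choice $p + q s$ is $p$ or $1$, hence nonzero.\<close>
  define s where "s = (if p = 0 then inverse q else 0)"
  have "p + q * s \<noteq> 0" using False by (auto simp: s_def)
  moreover obtain z where "z ^ k = p + q * s" using roots by blast
  ultimately show ?thesis using power_with_top_row[OF k] by blast
qed

text \<open>Each of the two inequations excludes at most one value of $s$, and $0, 1, 2$ are three
  different candidates.\<close>

lemma avoid_two_values:
  fixes p q u v w :: "'a::division_ring"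
  assumes "p \<noteq> 0 \<or> q \<noteq> 0" "w \<noteq> 0 \<or> u \<noteq> 0"
    and two: "(2::'a) \<noteq> 0"
  shows "\<exists>s. p + q * s \<noteq> 0 \<and> u - s * w \<noteq> 0"
proof (rule ccontr)
  assume "\<not> ?thesis"
  then have *: "p + q * s = 0 \<or> u = s * w" for s by auto
  have q: "s = t" if "p + q * s = 0" "p + q * t = 0" for s t
  proof -
    from that have "q * s = q * t" by (metis add_left_cancel)
    moreover have "q \<noteq> 0" using that assms(1) by auto
    ultimately show ?thesis by simp
  qed
  have w: "s = t" if "u = s * w" "u = t * w" for s t
  proof -
    from that have "s * w = t * w" by metis
    moreover have "w \<noteq> 0" using that assms(2) by auto
    ultimately show ?thesis by simp
  qed
  have "(0::'a) \<noteq> 1" "(0::'a) \<noteq> 2" "(1::'a) \<noteq> 2"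
    using two by (auto simp flip: one_add_one)
  then show False
    using *[of 0] *[of 1] *[of 2] q w by metis
qed

text \<open>Let $z$ be the second column of $N^{-1}$. If $X^{k_1}$ has the same top row as $M$ and $r$ is
  the difference of the bottom rows, then $N^{-1} (M - X^{k_1}) = z r$, which has a $k_2$-th root if
  $r z \neq 0$. If the top row vanishes, $X = 0$ is taken. Otherwise the bottom row of $X^{k_1}$ is $s$ times
  the top row, and $r z = 0$ for at most one $s$, except when both rows of $M$ are orthogonal to
  $z$. The last hypothesis, that the second
  column of $M N^{-1}$ is nonzero, rules this out.\<close>

lemma power_sum_column:
  fixes N M :: "'a::division_ring^2^2"
  assumes k1: "k1 \<ge> 1" and roots1: "\<And>c :: 'a. \<exists>z. z ^ k1 = c"
    and k2: "k2 \<ge> 1" and roots2: "\<And>c :: 'a. \<exists>z. z ^ k2 = c"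
    and two: "(2::'a) \<noteq> 0"
    and N: "N ** N' = mat 1"
    and col: "M ** N' ** mat22 0 0 0 1 \<noteq> 0"
  shows "\<exists>X Y. matrix_power X k1 + N ** matrix_power Y k2 = M"
proof -
  obtain p q m n where M: "M = mat22 p q m n" by (rule mat22_cases)
  obtain g1 z1 g2 z2 where N': "N' = mat22 g1 z1 g2 z2" by (rule mat22_cases)
  have mz: "p * z1 + q * z2 \<noteq> 0 \<or> m * z1 + n * z2 \<noteq> 0"
    using col by (auto simp: M N' mat22_mult zero_mat22)
  have "\<exists>X s. matrix_power X k1 = mat22 p q (s * p) (s * q)
      \<and> (m * z1 + n * z2) - s * (p * z1 + q * z2) \<noteq> 0"
  proof (cases "p = 0 \<and> q = 0")
    case True
    then show ?thesis
      using mz matrix_power_zero[OF k1, where 'a='a and 'n=2]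
      by (intro exI[of _ 0]) (auto simp: zero_mat22)
  next
    case False
    then obtain s where s: "p + q * s \<noteq> 0" "(m * z1 + n * z2) - s * (p * z1 + q * z2) \<noteq> 0"
      using avoid_two_values[of p q "p * z1 + q * z2" "m * z1 + n * z2"] mz two by blast
    obtain z where "z ^ k1 = p + q * s" using roots1 by blast
    with power_with_top_row[OF k1 this s(1)] s(2) show ?thesis by blast
  qed
  then obtain X s where X: "matrix_power X k1 = mat22 p q (s * p) (s * q)"
    and s: "(m * z1 + n * z2) - s * (p * z1 + q * z2) \<noteq> 0" by blast
  define a b where "a = m - s * p" and "b = n - s * q"
  have "a * z1 + b * z2 = (m * z1 + n * z2) - s * (p * z1 + q * z2)"
    by (simp add: a_def b_def algebra_simps)
  with s have ab: "a * z1 + b * z2 \<noteq> 0" by simp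
  obtain z where "z ^ k2 = a * z1 + b * z2" using roots2 by blast
  then obtain Y where "matrix_power Y k2 = mat22 (z1 * a) (z1 * b) (z2 * a) (z2 * b)"
    using outer_product_root[OF k2 _ ab] by blast
  also have "\<dots> = N' ** mat22 0 0 a b"
    by (simp add: N' mat22_mult)
  finally have "N ** matrix_power Y k2 = mat22 0 0 a b"
    using N by (metis matrix_mul_assoc matrix_mul_lid)
  with X have "matrix_power X k1 + N ** matrix_power Y k2 = M"
    by (simp add: M mat22_add a_def b_def)
  then show ?thesis by blast
qed

text \<open>If $M \neq 0$, then $M N^{-1}$ has a nonzero column, and exchanging the two coordinates makes
  it the second one.\<close>

lemma power_sum_of_roots:
  fixes N M :: "'a::division_ring^2^2"
  assumes k1: "k1 \<ge> 1" and roots1: "\<And>c :: 'a. \<exists>z. z ^ k1 = c"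
    and k2: "k2 \<ge> 1" and roots2: "\<And>c :: 'a. \<exists>z. z ^ k2 = c"
    and two: "(2::'a) \<noteq> 0"
    and N: "invertible N"
  shows "\<exists>X Y. matrix_power X k1 + N ** matrix_power Y k2 = M"
proof (cases "M = 0")
  case True
  have "matrix_power 0 k1 + N ** matrix_power 0 k2 = (0 :: 'a^2^2)"
    using k1 k2 by (simp add: matrix_power_zero)
  with True show ?thesis by blast
next
  case False
  obtain N' where N': "N ** N' = mat 1" "N' ** N = mat 1"
    using N by (rule invertible_obtains_inverse)
  define P :: "'a^2^2" where "P = mat22 0 1 1 0"
  have P: "P ** P = mat 1" by (simp add: P_def mat22_mult mat_1_mat22)
  show ?thesis
  proof (cases "M ** N' ** mat22 0 0 0 1 = 0")
    case False
    then show ?thesis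
      using power_sum_column[OF k1 roots1 k2 roots2 two N'(1)] by blast
  next
    case True
    obtain a b c d where W: "M ** N' = mat22 a b c d" by (rule mat22_cases)
    have bd: "b = 0" "d = 0"
      using True by (auto simp: W mat22_mult zero_mat22)
    have ac: "\<not> (a = 0 \<and> c = 0)"
    proof
      assume "a = 0 \<and> c = 0"
      then have "M ** N' = 0" using W bd by (simp add: zero_mat22)
      then have "M ** (N' ** N) = 0 ** N" by (simp add: matrix_mul_assoc)
      then show False using False N' by simp
    qed
    have "(P ** N ** P) ** (P ** N' ** P) = P ** N ** (P ** P) ** N' ** P"
      by (simp add: matrix_mul_assoc)
    also have "\<dots> = P ** (N ** N') ** P"
      using P by (simp add: matrix_mul_assoc)
    finally have inv: "(P ** N ** P) ** (P ** N' ** P) = mat 1"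
      using P N' by simp
    have "(P ** M ** P) ** (P ** N' ** P) = P ** M ** (P ** P) ** N' ** P"
      by (simp add: matrix_mul_assoc)
    also have "\<dots> = P ** (M ** N') ** P"
      using P by (simp add: matrix_mul_assoc)
    finally have "(P ** M ** P) ** (P ** N' ** P) ** mat22 0 0 0 1 \<noteq> 0"
      using ac by (auto simp: W P_def mat22_mult zero_mat22)
    then have "\<exists>X Y. matrix_power X k1 + (P ** N ** P) ** matrix_power Y k2 = P ** M ** P"
      by (rule power_sum_column[OF k1 roots1 k2 roots2 two inv])
    then show ?thesis by (rule power_sum_conjugate[OF P P])
  qed
qed

section \<open>Roots of quaternions\<close>

text \<open>Every quaternion lies in a copy $\mathbb R + \mathbb R u$ of the complex numbers with $u$ a
  purely imaginary unit.\<close>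

lemma quaternion_root:
  fixes c :: quat
  assumes k: "k \<ge> 1"
  shows "\<exists>z. z ^ k = c"
proof -
  define r where "r = sqrt ((qI c)\<^sup>2 + (qJ c)\<^sup>2 + (qK c)\<^sup>2)"
  obtain a b g where unit: "a\<^sup>2 + b\<^sup>2 + g\<^sup>2 = (1::real)"
    and c: "qI c = r * a" "qJ c = r * b" "qK c = r * g"
  proof (cases "r = 0")
    case True
    then have "qI c = 0" "qJ c = 0" "qK c = 0"
      by (simp_all add: r_def add_nonneg_eq_0_iff)
    with that[of 1 0 0] True show ?thesis by simp
  next
    case False
    have "r\<^sup>2 = (qI c)\<^sup>2 + (qJ c)\<^sup>2 + (qK c)\<^sup>2"
      by (simp add: r_def)
    with False have "(qI c)\<^sup>2 + (qJ c)\<^sup>2 + (qK c)\<^sup>2 \<noteq> 0"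
      by (metis zero_eq_power2)
    with \<open>r\<^sup>2 = _\<close> have "(qI c / r)\<^sup>2 + (qJ c / r)\<^sup>2 + (qK c / r)\<^sup>2 = 1"
      by (simp add: power_divide flip: add_divide_distrib)
    with that[of "qI c / r" "qJ c / r" "qK c / r"] False show ?thesis by simp
  qed
  define emb where "emb w = Quat (Re w) (Im w * a) (Im w * b) (Im w * g)" for w
  have unit': "a * (a * x) + (b * (b * x) + g * (g * x)) = x" for x
  proof -
    have "a * (a * x) + (b * (b * x) + g * (g * x)) = (a\<^sup>2 + b\<^sup>2 + g\<^sup>2) * x"
      by (simp add: power2_eq_square algebra_simps)
    then show ?thesis by (simp add: unit)
  qed
  have emb_mult: "emb (v * w) = emb v * emb w" for v w
    using unit'[of "Im v * Im w"]
    by (simp add: emb_def quat_eq_iff algebra_simps)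
  have emb_power: "emb (w ^ n) = emb w ^ n" for w n
    by (induction n) (simp_all add: emb_mult, simp add: emb_def quat_eq_iff)
  have "emb (Complex (qRe c) r) = c"
    using c by (simp add: emb_def quat_eq_iff)
  moreover obtain w where "w ^ k = Complex (qRe c) r"
    using exists_complex_root[of k "Complex (qRe c) r"] k by (metis not_one_le_zero)
  ultimately show ?thesis by (metis emb_power)
qed

section \<open>Roots of real 2x2 matrices\<close>

text \<open>The matrix $J$ with rows $(\alpha, \beta)$ and $(\gamma, -\alpha)$ satisfies $J^2 = -I$, so
  $x + i y \mapsto x I + y J$ is a ring homomorphism and transports complex roots.\<close>

lemma power_in_complex_plane:
  fixes \<alpha> \<beta> \<gamma> u v :: real
  assumes k: "k \<ge> 1" and J: "\<alpha>\<^sup>2 + \<beta> * \<gamma> = -1"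
  shows "\<exists>Y. matrix_power Y k = mat22 (u + v * \<alpha>) (v * \<beta>) (v * \<gamma>) (u - v * \<alpha>)"
proof -
  define emb where "emb w = mat22 (Re w + Im w * \<alpha>) (Im w * \<beta>) (Im w * \<gamma>) (Re w - Im w * \<alpha>)" for w
  have J': "\<beta> * (\<gamma> * x) = - x - \<alpha> * (\<alpha> * x)" for x
  proof -
    have "(\<alpha>\<^sup>2 + \<beta> * \<gamma>) * x = - x" by (simp add: J)
    then show ?thesis by (simp add: power2_eq_square algebra_simps)
  qed
  have emb_mult: "emb (w * z) = emb w ** emb z" for w z
    using J'[of "Im w * Im z"]
    by (simp add: emb_def mat22_mult algebra_simps)
  have "emb 1 = mat 1"
    by (simp add: emb_def mat_1_mat22)
  then have emb_power: "emb (w ^ n) = matrix_power (emb w) n" for w n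
    by (induction n) (simp_all add: emb_mult)
  obtain w where "Complex u v = w ^ k"
    using exists_complex_root[of k "Complex u v"] k by (metis not_one_le_zero)
  then have "matrix_power (emb w) k = emb (Complex u v)"
    by (simp add: emb_power)
  then show ?thesis by (auto simp: emb_def)
qed

lemma scalar_matrix_root:
  fixes u :: real
  assumes "k \<ge> 1"
  shows "\<exists>Y. matrix_power Y k = mat22 u 0 0 u"
  using power_in_complex_plane[OF assms, of 0 1 "-1" u 0] by simp

text \<open>The hypothesis says that the characteristic polynomial has negative discriminant. With
  $v = \sqrt{-\mathrm{disc}}/2$ the traceless part divided by $v$ squares to $-I$.\<close>

lemma elliptic_matrix_root:
  fixes a b c d :: real
  assumes k: "k \<ge> 1" and disc: "(a - d)\<^sup>2 + 4 * (b * c) < 0"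
  shows "\<exists>Y. matrix_power Y k = mat22 a b c d"
proof -
  define v where "v = sqrt (- ((a - d)\<^sup>2 + 4 * (b * c))) / 2"
  have v0: "v \<noteq> 0" using disc by (simp add: v_def)
  have "4 * v\<^sup>2 = - ((a - d)\<^sup>2 + 4 * (b * c))"
    using disc by (simp add: v_def power_divide)
  then have "((a - d) / (2 * v))\<^sup>2 + (b / v) * (c / v) = -1"
    using v0 by (simp add: field_simps power2_eq_square)
  then obtain Y where "matrix_power Y k = mat22 ((a + d) / 2 + v * ((a - d) / (2 * v)))
      (v * (b / v)) (v * (c / v)) ((a + d) / 2 - v * ((a - d) / (2 * v)))"
    using power_in_complex_plane[OF k] by blast
  moreover have "(a + d) / 2 + v * ((a - d) / (2 * v)) = a" "(a + d) / 2 - v * ((a - d) / (2 * v)) = d"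
    using v0 by (simp_all add: field_simps)
  ultimately show ?thesis using v0 by auto
qed

text \<open>For $q \neq 0$ a bottom row is chosen that makes $(p, q; sp, sq)$ idempotent. For $q = 0$ the
  scalar matrix $p I$ is a power, whatever the sign of $p$.\<close>

lemma power_rows_real:
  fixes p q :: real
  assumes k: "k \<ge> 1"
  shows "\<exists>Y c d. matrix_power Y k = mat22 p q c d"
proof (cases "q = 0")
  case True
  with scalar_matrix_root[OF k, of p] show ?thesis by blast
next
  case False
  then have "1 ^ k = p + q * ((1 - p) / q)" "p + q * ((1 - p) / q) \<noteq> 0" by simp_all
  then show ?thesis using power_with_top_row[OF k] by blast
qed

section \<open>Sums of powers of real matrices\<close>

lemma linear_eventually_negative:
  fixes L F :: real
  assumes "L < 0"
  shows "\<exists>t>0. L * t + F < 0"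
proof (intro exI conjI)
  show "(\<bar>F\<bar> + 1) / (- L) > 0" using assms by (simp add: divide_pos_neg)
  have "L * ((\<bar>F\<bar> + 1) / (- L)) = - (\<bar>F\<bar> + 1)" using assms by simp
  then show "L * ((\<bar>F\<bar> + 1) / (- L)) + F < 0" by linarith
qed

lemma quadratic_eventually_negative:
  fixes D E F :: real
  assumes "D < 0"
  shows "\<exists>t>0. D * t\<^sup>2 + E * t + F < 0"
proof -
  obtain t where t: "t > 0" "D * t + (\<bar>E\<bar> + \<bar>F\<bar> - D) < 0"
    using linear_eventually_negative[OF assms] by blast
  have t1: "t \<ge> 1"
  proof (rule ccontr)
    assume "\<not> t \<ge> 1"
    then have "D * t \<ge> D * 1" using assms by (intro mult_left_mono_neg) auto
    then show False using t by linarith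
  qed
  have "D * t\<^sup>2 + E * t + F \<le> (D * t + \<bar>E\<bar> + \<bar>F\<bar>) * t"
  proof -
    have "E * t \<le> \<bar>E\<bar> * t" using t1 by (intro mult_right_mono) auto
    moreover have "F \<le> \<bar>F\<bar> * t"
      using t1 mult_left_mono[of 1 t "\<bar>F\<bar>"] by simp
    ultimately show ?thesis by (simp add: power2_eq_square algebra_simps)
  qed
  also have "\<dots> < 0"
    using t assms by (intro mult_neg_pos) linarith+
  finally show ?thesis using t by blast
qed

text \<open>The two hypotheses are the negative discriminants of $Z = (p, q; r, s)$ and of $M - N Z$.\<close>

lemma power_sum_elliptic:
  fixes a b c d :: real
  assumes k: "k1 \<ge> 1" "k2 \<ge> 1"
    and Z: "(p - s)\<^sup>2 + 4 * (q * r) < 0"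
    and W: "((a - (n1 * p + n2 * r)) - (d - (n3 * q + n4 * s)))\<^sup>2
      + 4 * ((b - (n1 * q + n2 * s)) * (c - (n3 * p + n4 * r))) < 0"
  shows "\<exists>X Y. matrix_power X k1 + mat22 n1 n2 n3 n4 ** matrix_power Y k2 = mat22 a b c d"
proof -
  obtain Y where "matrix_power Y k2 = mat22 p q r s"
    using elliptic_matrix_root[OF k(2) Z] by blast
  moreover obtain X where "matrix_power X k1 = mat22 (a - (n1 * p + n2 * r)) (b - (n1 * q + n2 * s))
      (c - (n3 * p + n4 * r)) (d - (n3 * q + n4 * s))"
    using elliptic_matrix_root[OF k(1) W] by blast
  ultimately have "matrix_power X k1 + mat22 n1 n2 n3 n4 ** matrix_power Y k2 = mat22 a b c d"
    by (simp add: mat22_mult mat22_add)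
  then show ?thesis by blast
qed

text \<open>Let $Z = t (I + \mathrm{adj}\, N)$. Then $N Z = t (N + (\det N) I)$, so both $Z$ and $N Z$ have
  discriminant $t^2$ times that of $N$, and for large $t$ the term $M$ does not matter.\<close>

lemma power_sum_elliptic_coefficient:
  fixes n1 n2 n3 n4 a b c d :: real
  assumes k: "k1 \<ge> 1" "k2 \<ge> 1" and disc: "(n1 - n4)\<^sup>2 + 4 * (n2 * n3) < 0"
  shows "\<exists>X Y. matrix_power X k1 + mat22 n1 n2 n3 n4 ** matrix_power Y k2 = mat22 a b c d"
proof -
  define D where "D = (n1 - n4)\<^sup>2 + 4 * (n2 * n3)"
  obtain t where t: "t > 0"
    "D * t\<^sup>2 + (- (2 * (a - d) * (n1 - n4) + 4 * (b * n3 + c * n2))) * t + ((a - d)\<^sup>2 + 4 * (b * c)) < 0"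
    using quadratic_eventually_negative[of D] disc unfolding D_def by blast
  have "(t * (1 + n4) - t * (1 + n1))\<^sup>2 + 4 * ((- t * n2) * (- t * n3)) = t\<^sup>2 * D"
    by (simp add: D_def power2_eq_square algebra_simps)
  also have "\<dots> < 0"
    using t disc by (simp add: D_def mult_pos_neg)
  finally have Z: "(t * (1 + n4) - t * (1 + n1))\<^sup>2 + 4 * ((- t * n2) * (- t * n3)) < 0" .
  show ?thesis
    by (rule power_sum_elliptic[OF k Z], rule back_subst[of "\<lambda>x. x < 0", OF t(2)])
      (simp add: D_def power2_eq_square algebra_simps)
qed

text \<open>Let $Z$ have zero diagonal and entries $q, r$ off the diagonal. The product of the
  off-diagonal entries of $M - N Z$ is $(b - n_1 q)(c - n_2 r)$, and the diagonal does not depend on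
  $q$. So $r$ is fixed negative and large enough that $c - n_2 r$ has the sign of $n_2$, which is the
  sign of $n_1$, and then $q \to \infty$.\<close>

lemma power_sum_triangular_coefficient:
  fixes n1 n2 m a b c d :: real
  assumes k: "k1 \<ge> 1" "k2 \<ge> 1" and n: "n1 * n2 > 0"
  shows "\<exists>X Y. matrix_power X k1 + mat22 n1 m 0 n2 ** matrix_power Y k2 = mat22 a b c d"
proof -
  have n0: "n2 \<noteq> 0" using n by auto
  define r where "r = - (1 + \<bar>c\<bar> / \<bar>n2\<bar>)"
  have r: "r < 0"
  proof -
    have "0 \<le> \<bar>c\<bar> / \<bar>n2\<bar>" by simp
    then show ?thesis unfolding r_def by linarith
  qed
  have "n2 * (c - n2 * r) = n2 * c + n2\<^sup>2 + \<bar>n2\<bar> * \<bar>c\<bar>"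
  proof -
    have "n2 * (n2 * (\<bar>c\<bar> / \<bar>n2\<bar>)) = \<bar>n2\<bar> * (\<bar>n2\<bar> * (\<bar>c\<bar> / \<bar>n2\<bar>))"
      by (simp only: mult.assoc[symmetric] abs_mult_self_eq)
    also have "\<dots> = \<bar>n2\<bar> * \<bar>c\<bar>" using n0 by simp
    finally show ?thesis by (simp add: r_def algebra_simps power2_eq_square)
  qed
  moreover have "n2 * c \<ge> - (\<bar>n2\<bar> * \<bar>c\<bar>)"
    by (metis abs_ge_minus_self abs_mult minus_le_iff)
  ultimately have "n2 * (c - n2 * r) > 0"
    using n0 by (smt (verit) zero_less_power2)
  then have "n1 * (c - n2 * r) > 0"
    using n by (auto simp: zero_less_mult_iff)
  then have "- 4 * (n1 * (c - n2 * r)) < 0" by simp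
  then obtain q where q: "q > 0"
    "- 4 * (n1 * (c - n2 * r)) * q + ((a - d - m * r)\<^sup>2 + 4 * (b * (c - n2 * r))) < 0"
    using linear_eventually_negative by blast
  have Z: "(0 - 0)\<^sup>2 + 4 * (q * r) < 0"
    using q r by (simp add: mult_pos_neg)
  show ?thesis
    by (rule power_sum_elliptic[OF k Z], rule back_subst[of "\<lambda>x. x < 0", OF q(2)])
      (simp add: power2_eq_square algebra_simps)
qed

text \<open>A negative discriminant forces a positive determinant, so $Z$ and $-N Z$ cannot both have one,
  and scaling up a fixed $Z$ fails. If $b \neq 0$, let $Z$ have zero diagonal and the entries
  $q = b / (2 n_1)$, $r = -t q$. Then $q r < 0$, and the off-diagonal entries $b - n_1 q = b/2$ and
  $c - n_2 r$ of $M - N Z$ have a product that tends to $-\infty$ with $t$, because $n_1 n_2 < 0$.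
  The case $c \neq 0$ is symmetric. If $M$ is diagonal, some scalar matrix $p I$ makes
  $M - p N$ scalar.\<close>

lemma power_sum_diagonal_coefficient:
  fixes n1 n2 a b c d :: real
  assumes k: "k1 \<ge> 1" "k2 \<ge> 1" and n: "n1 * n2 < 0"
  shows "\<exists>X Y. matrix_power X k1 + mat22 n1 0 0 n2 ** matrix_power Y k2 = mat22 a b c d"
proof -
  have n0: "n1 \<noteq> 0" "n2 \<noteq> 0" "n1 \<noteq> n2" using n by (auto simp: mult_less_0_iff)
  consider "b \<noteq> 0" | "c \<noteq> 0" | "b = 0" "c = 0" by blast
  then show ?thesis
  proof cases
    case 1
    define q where "q = b / (2 * n1)"
    have q: "q \<noteq> 0" "n1 * q = b / 2" using 1 n0 by (simp_all add: q_def)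
    have "2 * b * (n2 * q) = (b / n1)\<^sup>2 * (n1 * n2)"
      using n0 by (simp add: q_def power2_eq_square)
    also have "\<dots> < 0" using 1 n0 by (intro mult_pos_neg[OF _ n]) simp
    finally obtain t where t: "t > 0" "2 * b * (n2 * q) * t + ((a - d)\<^sup>2 + 2 * b * c) < 0"
      using linear_eventually_negative by blast
    have "(0 - 0)\<^sup>2 + 4 * (q * (- t * q)) = - 4 * (t * q\<^sup>2)"
      by (simp add: power2_eq_square)
    also have "\<dots> < 0" using t q by simp
    finally have Z: "(0 - 0)\<^sup>2 + 4 * (q * (- t * q)) < 0" .
    show ?thesis
      by (rule power_sum_elliptic[OF k Z], rule back_subst[of "\<lambda>x. x < 0", OF t(2)])
        (simp add: q power2_eq_square algebra_simps)
  next
    case 2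
    define r where "r = c / (2 * n2)"
    have r: "r \<noteq> 0" "n2 * r = c / 2" using 2 n0 by (simp_all add: r_def)
    have "2 * c * (n1 * r) = (c / n2)\<^sup>2 * (n1 * n2)"
      using n0 by (simp add: r_def power2_eq_square)
    also have "\<dots> < 0" using 2 n0 by (intro mult_pos_neg[OF _ n]) simp
    finally obtain t where t: "t > 0" "2 * c * (n1 * r) * t + ((a - d)\<^sup>2 + 2 * b * c) < 0"
      using linear_eventually_negative by blast
    have "(0 - 0)\<^sup>2 + 4 * ((- t * r) * r) = - 4 * (t * r\<^sup>2)"
      by (simp add: power2_eq_square)
    also have "\<dots> < 0" using t r by simp
    finally have Z: "(0 - 0)\<^sup>2 + 4 * ((- t * r) * r) < 0" .
    show ?thesis
      by (rule power_sum_elliptic[OF k Z], rule back_subst[of "\<lambda>x. x < 0", OF t(2)])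
        (simp add: r power2_eq_square algebra_simps)
  next
    case 3
    \<comment> \<open>The scalar for which the two diagonal entries of $M - p N$ agree.\<close>
    define p where "p = (a - d) / (n1 - n2)"
    have p: "a - n1 * p = d - n2 * p"
    proof -
      have "(n1 - n2) * p = a - d" using n0 by (simp add: p_def)
      then show ?thesis by (simp add: algebra_simps)
    qed
    obtain Y where "matrix_power Y k2 = mat22 p 0 0 p"
      using scalar_matrix_root[OF k(2)] by blast
    moreover obtain X where "matrix_power X k1 = mat22 (a - n1 * p) 0 0 (a - n1 * p)"
      using scalar_matrix_root[OF k(1)] by blast
    ultimately have "matrix_power X k1 + mat22 n1 0 0 n2 ** matrix_power Y k2 = mat22 a b c d"
      using 3 p by (simp add: mat22_mult mat22_add)
    then show ?thesis by blast
  qed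
qed

lemma power_sum_triangular:
  fixes n1 n2 m :: real and M :: "real^2^2"
  assumes k: "k1 \<ge> 1" "k2 \<ge> 1" and n: "n1 * n2 \<noteq> 0"
  shows "\<exists>X Y. matrix_power X k1 + mat22 n1 m 0 n2 ** matrix_power Y k2 = M"
proof (cases "n1 * n2 > 0")
  case True
  then show ?thesis
    using power_sum_triangular_coefficient[OF k True] by (metis mat22_cases)
next
  case False
  with n have neg: "n1 * n2 < 0" by linarith
  then have "n1 \<noteq> n2" by (auto simp: mult_less_0_iff)
  define h where "h = m / (n2 - n1)"
  have h: "n1 * h + m - h * n2 = 0"
  proof -
    have "h * (n2 - n1) = m" using \<open>n1 \<noteq> n2\<close> by (simp add: h_def)
    then show ?thesis by (simp add: algebra_simps)
  qed
  define P P' where "P = mat22 1 h 0 1" and "P' = mat22 1 (- h) 0 1"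
  have P: "P ** P' = mat 1" "P' ** P = mat 1"
    by (simp_all add: P_def P'_def mat22_mult mat_1_mat22)
  have "P' ** mat22 n1 m 0 n2 ** P = mat22 n1 0 0 n2"
    using h by (simp add: P_def P'_def mat22_mult algebra_simps)
  then have "\<exists>X Y. matrix_power X k1 + (P' ** mat22 n1 m 0 n2 ** P) ** matrix_power Y k2 = P' ** M ** P"
    using power_sum_diagonal_coefficient[OF k neg] by (metis mat22_cases)
  then show ?thesis by (rule power_sum_conjugate[OF P])
qed

text \<open>If $N$ has a real eigenvalue $l$ and lower left entry $n_3 \neq 0$, then $(l - n_4, n_3)^T$ is an
  eigenvector, and completing it to a basis triangularizes $N$.\<close>

lemma power_sum_real:
  fixes N M :: "real^2^2"
  assumes k: "k1 \<ge> 1" "k2 \<ge> 1" and N: "invertible N"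
  shows "\<exists>X Y. matrix_power X k1 + N ** matrix_power Y k2 = M"
proof -
  obtain n1 n2 n3 n4 where Neq: "N = mat22 n1 n2 n3 n4" by (rule mat22_cases)
  define \<delta> where "\<delta> = n1 * n4 - n2 * n3"
  have \<delta>: "\<delta> \<noteq> 0"
    using N by (simp add: invertible_det_nz det_2 Neq \<delta>_def)
  consider "(n1 - n4)\<^sup>2 + 4 * (n2 * n3) < 0" | "n3 = 0"
    | "(n1 - n4)\<^sup>2 + 4 * (n2 * n3) \<ge> 0" "n3 \<noteq> 0" by linarith
  then show ?thesis
  proof cases
    case 1
    then show ?thesis
      unfolding Neq using power_sum_elliptic_coefficient[OF k 1] by (metis mat22_cases)
  next
    case 2
    then show ?thesis
      unfolding Neq using power_sum_triangular[OF k] \<delta> by (simp add: \<delta>_def)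
  next
    case 3
    define R where "R = sqrt ((n1 - n4)\<^sup>2 + 4 * (n2 * n3))"
    define l where "l = (n1 + n4 + R) / 2"
    have "2 * l - (n1 + n4) = R"
      unfolding l_def by (simp add: field_simps)
    then have "(2 * l - (n1 + n4))\<^sup>2 = (n1 - n4)\<^sup>2 + 4 * (n2 * n3)"
      using 3 by (simp add: R_def)
    then have l: "l * (n1 + n4 - l) = \<delta>"
      by (simp add: \<delta>_def power2_eq_square algebra_simps)
    define P P' where "P = mat22 (l - n4) 1 n3 0" and "P' = mat22 0 (1 / n3) 1 (- (l - n4) / n3)"
    have P: "P ** P' = mat 1" "P' ** P = mat 1"
      using 3 by (simp_all add: P_def P'_def mat22_mult mat_1_mat22 flip: add_divide_distrib)
    have NP: "N ** P = mat22 (l * (l - n4)) n1 (l * n3) n3"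
      using l by (simp add: Neq P_def mat22_mult \<delta>_def algebra_simps)
    have "P' ** (N ** P) = mat22 l 1 0 (n1 + n4 - l)"
      unfolding NP using 3 by (simp add: P'_def mat22_mult field_simps)
    then have "P' ** N ** P = mat22 l 1 0 (n1 + n4 - l)"
      by (simp add: matrix_mul_assoc)
    moreover have "l * (n1 + n4 - l) \<noteq> 0"
      using l \<delta> by argo
    ultimately have "\<exists>X Y. matrix_power X k1 + (P' ** N ** P) ** matrix_power Y k2 = P' ** M ** P"
      using power_sum_triangular[OF k, of l "n1 + n4 - l" 1] by simp
    then show ?thesis by (rule power_sum_conjugate[OF P])
  qed
qed

section \<open>The image of the word map over the reals and the quaternions\<close>

theorem theorem1p4:
  shows
  "(\<forall>(A :: real^2^2) (B :: real^2^2) (k1 :: nat) (k2 :: nat).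
      A \<noteq> 0 \<and> B \<noteq> 0 \<and> k1 \<ge> 1 \<and> k2 \<ge> 1 \<longrightarrow>
      (surj (word_map A B k1 k2) \<longleftrightarrow>
         (invertible A \<or> invertible B) \<or>
         (\<not> invertible A \<and> \<not> invertible B \<and> row_ratio A \<noteq> row_ratio B)) \<and>
      (range (word_map A B k1 k2) \<noteq> UNIV \<longleftrightarrow>
         \<not> invertible A \<and> \<not> invertible B \<and> row_ratio A = row_ratio B) \<and>
      (\<not> invertible A \<and> \<not> invertible B \<and> row_ratio A = row_ratio B \<longrightarrow>
         range (word_map A B k1 k2) =
           {M. \<not> invertible M \<and> M \<noteq> 0 \<and> row_ratio M = row_ratio A} \<union> {0}))
   \<and>
   (\<forall>(A :: quat^2^2) (B :: quat^2^2) (k1 :: nat) (k2 :: nat).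
      A \<noteq> 0 \<and> B \<noteq> 0 \<and> k1 \<ge> 1 \<and> k2 \<ge> 1 \<longrightarrow>
      (surj (word_map A B k1 k2) \<longleftrightarrow>
         (invertible A \<or> invertible B) \<or>
         (\<not> invertible A \<and> \<not> invertible B \<and> row_ratio A \<noteq> row_ratio B)) \<and>
      (range (word_map A B k1 k2) \<noteq> UNIV \<longleftrightarrow>
         \<not> invertible A \<and> \<not> invertible B \<and> row_ratio A = row_ratio B) \<and>
      (\<not> invertible A \<and> \<not> invertible B \<and> row_ratio A = row_ratio B \<longrightarrow>
         range (word_map A B k1 k2) =
           {M. \<not> invertible M \<and> M \<noteq> 0 \<and> row_ratio M = row_ratio A} \<union> {0}))"
proof (rule conjI; intro allI impI; elim conjE)
  fix A B :: "real^2^2" and k1 k2 :: nat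
  assume *: "A \<noteq> 0" "B \<noteq> 0" and k: "k1 \<ge> 1" "k2 \<ge> 1"
  show "(surj (word_map A B k1 k2) \<longleftrightarrow>
         (invertible A \<or> invertible B) \<or>
         (\<not> invertible A \<and> \<not> invertible B \<and> row_ratio A \<noteq> row_ratio B)) \<and>
      (range (word_map A B k1 k2) \<noteq> UNIV \<longleftrightarrow>
         \<not> invertible A \<and> \<not> invertible B \<and> row_ratio A = row_ratio B) \<and>
      (\<not> invertible A \<and> \<not> invertible B \<and> row_ratio A = row_ratio B \<longrightarrow>
         range (word_map A B k1 k2) =
           {M. \<not> invertible M \<and> M \<noteq> 0 \<and> row_ratio M = row_ratio A} \<union> {0})"
    using power_rows_real[OF k(1)] power_rows_real[OF k(2)] power_sum_real[OF k] *
    by (rule word_map_image_of_power_rows)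
next
  fix A B :: "quat^2^2" and k1 k2 :: nat
  assume *: "A \<noteq> 0" "B \<noteq> 0" and k: "k1 \<ge> 1" "k2 \<ge> 1"
  have "qRe (1 + 1) = 2"
    unfolding plus_quat.simps one_quat.simps by (rule one_add_one)
  then have two: "(2 :: quat) \<noteq> 0"
    by (metis one_add_one zero_quat.simps(1) zero_neq_numeral)
  show "(surj (word_map A B k1 k2) \<longleftrightarrow>
         (invertible A \<or> invertible B) \<or>
         (\<not> invertible A \<and> \<not> invertible B \<and> row_ratio A \<noteq> row_ratio B)) \<and>
      (range (word_map A B k1 k2) \<noteq> UNIV \<longleftrightarrow>
         \<not> invertible A \<and> \<not> invertible B \<and> row_ratio A = row_ratio B) \<and>
      (\<not> invertible A \<and> \<not> invertible B \<and> row_ratio A = row_ratio B \<longrightarrow>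
         range (word_map A B k1 k2) =
           {M. \<not> invertible M \<and> M \<noteq> 0 \<and> row_ratio M = row_ratio A} \<union> {0})"
    using power_rows_of_roots[OF k(1) quaternion_root[OF k(1)]]
      power_rows_of_roots[OF k(2) quaternion_root[OF k(2)]]
      power_sum_of_roots[OF k(1) quaternion_root[OF k(1)] k(2) quaternion_root[OF k(2)] two] *
    by (rule word_map_image_of_power_rows)
qed

end
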